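(* Let $\mathcal H$ be a real Hilbert space, $C\subseteq\mathcal H$ nonempty, closed and convex, and $F:\mathcal H\to\mathcal H$. Assume that $SOL(C,F)\neq\emptyset$, that $F$ is monotone on $\mathcal H$ ($\langle F(x)-F(y),x-y\rangle\ge 0$ for all $x,y\in\mathcal H$), and that $F$ is Lipschitz continuous on $\mathcal H$ with some constant $L>0$. Assume that the sequence $\{v^k\}_{k=0}^\infty\subset\mathcal H$ is bounded and that the positive scalars $\{\lambda_k\}_{k=0}^\infty$ satisfy $\sum_{k=0}^\infty\lambda_k<+\infty$. Then any sequence $\{x^k\}_{k=0}^\infty$ generated by the PC-algorithm I with bounded perturbations (described in the context) converges weakly to a point of $SOL(C,F)$, i.e. to a solution of the variational inequality problem.
   Context: The variational inequality problem is: find $x^*\in C$ with $\langle F(x^* ),x-x^*\rangle\ge 0$ for all $x\in C$; its solution set is $SOL(C,F)$. $P_C$ denotes the metric projection onto $C$. PC-algorithm I with bounded perturbations: fix $\nu\in(0,1)$ and $\gamma\in(0,2)$. Take $x^0\in\mathcal H$ arbitrarily. Given $x^k\in\mathcal H$, set $$y^k=P_C\big((x^k+\lambda_kv^k)-\beta_kF(x^k+\lambda_kv^k)\big),$$ where $\beta_k>0$ is selected to satisfy $$\beta_k\|F(x^k+\lambda_kv^k)-F(y^k)\|\le\nu\|x^k+\lambda_kv^k-y^k\|.$$ Define $$d(x^k+\lambda_kv^k,y^k)=(x^k+\lambda_kv^k-y^k)-\beta_k\big(F(x^k+\lambda_kv^k)-F(y^k)\big),$$ $$\rho_k=\frac{\langle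 x^k+\lambda_kv^k-y^k,d(x^k+\lambda_kv^k,y^k)\rangle}{\|d(x^k+\lambda_kv^k,y^k)\|^2},\qquad x^{k+1}=(x^k+\lambda_kv^k)-\gamma\rho_kd(x^k+\lambda_kv^k,y^k).$$ It is understood that $d(x^k+\lambda_kv^k,y^k)\ne0$ for all $k$, so that $\rho_k$ is defined.
   Formalization: The formal theorem additionally assumes that the step sizes β_k are bounded below by a positive constant; without this the claim fails (e.g. F = id on the real line, v = 0, γ = 1, ν = 1/2, β_k = 1/(k+2)², x^0 = 2, where x^k → 1 but the only solution is 0). *)

theory Defs
  imports "HOL-Analysis.Analysis"
begin

text \<open>
  A real Hilbert space is a type of class \<open>{real_inner, complete_space}\<close>.

  The library constant \<open>closest_point\<close> requires the class \<open>heine_borel\<close>, which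
  rules out infinite-dimensional spaces. The metric projection is therefore
  defined here by the same formula, without that restriction.
\<close>

definition metric_proj :: "'a::real_inner set \<Rightarrow> 'a \<Rightarrow> 'a" where
  "metric_proj C x = (SOME p. p \<in> C \<and> (\<forall>q\<in>C. dist x p \<le> dist x q))"

definition SOL :: "'a::real_inner set \<Rightarrow> ('a \<Rightarrow> 'a) \<Rightarrow> 'a set" where
  "SOL C F = {z \<in> C. \<forall>x\<in>C. inner (F z) (x - z) \<ge> 0}"

definition monotone_operator :: "('a::real_inner \<Rightarrow> 'a) \<Rightarrow> bool" where
  "monotone_operator F \<longleftrightarrow> (\<forall>x y. inner (F x - F y) (x - y) \<ge> 0)"

definition converges_weakly :: "(nat \<Rightarrow> 'a::real_inner) \<Rightarrow> 'a \<Rightarrow> bool" where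
  "converges_weakly x l \<longleftrightarrow> (\<forall>z. (\<lambda>k. inner (x k) z) \<longlonglongrightarrow> inner l z)"

definition pc_direction :: "('a::real_inner \<Rightarrow> 'a) \<Rightarrow> real \<Rightarrow> 'a \<Rightarrow> 'a \<Rightarrow> 'a" where
  "pc_direction F b w y = (w - y) - b *\<^sub>R (F w - F y)"

definition pc_step :: "('a::real_inner \<Rightarrow> 'a) \<Rightarrow> real \<Rightarrow> 'a \<Rightarrow> 'a \<Rightarrow> real" where
  "pc_step F b w y =
     inner (w - y) (pc_direction F b w y) / (norm (pc_direction F b w y))\<^sup>2"

text \<open>
  A run of the perturbed method. The starting point \<open>x 0\<close> is unconstrained, and the
  step sizes \<open>\<beta> k\<close> are part of the run: any positive value passing the test may be
  chosen. In particular this predicate alone does not exclude \<open>\<beta> k\<close> tending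
  to 0; a positive lower bound has to be assumed separately. The condition that the direction is nonzero makes the quotient in
  \<open>pc_step\<close> a genuine one.
\<close>

definition pc_algorithm_I_perturbed ::
  "'a::real_inner set \<Rightarrow> ('a \<Rightarrow> 'a) \<Rightarrow> real \<Rightarrow> real \<Rightarrow> (nat \<Rightarrow> 'a) \<Rightarrow> (nat \<Rightarrow> real) \<Rightarrow>
   (nat \<Rightarrow> real) \<Rightarrow> (nat \<Rightarrow> 'a) \<Rightarrow> (nat \<Rightarrow> 'a) \<Rightarrow> bool" where
  "pc_algorithm_I_perturbed C F \<nu> \<gamma> v lam \<beta> x y \<longleftrightarrow>
     (\<forall>k. let w = x k + lam k *\<^sub>R v k in
        \<beta> k > 0 \<and>
        y k = metric_proj C (w - \<beta> k *\<^sub>R F w) \<and>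
        \<beta> k * norm (F w - F (y k)) \<le> \<nu> * norm (w - y k) \<and>
        pc_direction F (\<beta> k) w (y k) \<noteq> 0 \<and>
        x (Suc k) = w - (\<gamma> * pc_step F (\<beta> k) w (y k)) *\<^sub>R pc_direction F (\<beta> k) w (y k))"

end

theory Submission
  imports Defs
begin

text \<open>
  One step of the method is a relaxed projection. Write \<open>w\<^sub>k = x\<^sub>k + lam\<^sub>k v\<^sub>k\<close> and let \<open>d\<^sub>k\<close> be the
  direction. The obtuse-angle property of the projection defining \<open>y\<^sub>k\<close>, together with
  monotonicity, gives \<open>\<langle>w\<^sub>k - z, d\<^sub>k\<rangle> \<ge> \<langle>w\<^sub>k - y\<^sub>k, d\<^sub>k\<rangle> > 0\<close> for every solution \<open>z\<close>: the hyperplane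
  through \<open>y\<^sub>k\<close> orthogonal to \<open>d\<^sub>k\<close> separates \<open>w\<^sub>k\<close> from all solutions. The next iterate is the
  projection of \<open>w\<^sub>k\<close> onto this hyperplane relaxed by the factor \<open>\<gamma>\<close>, so the squared distance to
  \<open>z\<close> drops by at least \<open>c \<parallel>w\<^sub>k - y\<^sub>k\<parallel>\<^sup>2\<close> with a fixed \<open>c > 0\<close> (\<open>pc_update_decrease\<close>).

  The perturbation costs at most \<open>lam\<^sub>k \<parallel>v\<^sub>k\<parallel>\<close>, which is summable. Hence \<open>\<parallel>x\<^sub>k - z\<parallel>\<close> converges for
  every solution \<open>z\<close> (\<open>convergent_quasi_decreasing\<close>), and then the decrease forces
  \<open>w\<^sub>k - y\<^sub>k \<rightarrow> 0\<close>. Because the step sizes are bounded below, the projection inequality passes to the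
  limit (\<open>projection_step_dual_gap\<close>) and shows that every weak cluster point \<open>p\<close> of the iterates
  solves the dual problem \<open>\<langle>F u, u - p\<rangle> \<ge> 0\<close> for all \<open>u \<in> C\<close>; by Minty's argument (\<open>minty\<close>) it is
  a solution. Opial's argument (\<open>opial_weak_convergence\<close>) turns these two facts,
  convergent distances and cluster points inside the solution set, into weak convergence.

  Weak compactness of bounded sequences is used through filters rather than subsequences. The
  functionals \<open>h \<mapsto> \<langle>x\<^sub>k, h\<rangle>\<close> lie in a product of compact intervals, so by Tychonoff's
  theorem they have a pointwise limit along some finer nontrivial filter, and the limit is
  represented by a vector by the Riesz theorem (\<open>weak_cluster_point_exists\<close>). The argument is the
  same in separable and nonseparable spaces, and limits along filters serve Opial's argument as
  well as subsequences do.
\<close>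

section \<open>Metric projection in Hilbert spaces\<close>

text \<open>
  By the parallelogram law, the midpoint of two points that are nearly
  closest to \<open>a\<close> would be closer still, by a quarter of their squared distance, so they cannot be
  far apart. Hence the sets of almost closest points form a
  nested family of closed sets with vanishing diameter, and completeness gives a common point.
\<close>

lemma closest_point_in_hilbert_exists:
  fixes C :: "'a::{real_inner, complete_space} set"
  assumes "C \<noteq> {}" "closed C" "convex C"
  shows "\<exists>p\<in>C. \<forall>q\<in>C. dist a p \<le> dist a q"
proof -
  define f where "f c = (dist a c)\<^sup>2" for c
  define m where "m = Inf (f ` C)"
  have bdd: "bdd_below (f ` C)"
    by (rule bdd_belowI[of _ 0]) (auto simp: f_def)
  have m_le: "m \<le> f c" if "c \<in> C" for c
    unfolding m_def using bdd that by (simp add: cInf_lower)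
  define S where "S n = {c \<in> C. f c \<le> m + 1 / real (Suc n)}" for n
  have S_eq: "S n = C \<inter> {c. f c \<le> m + 1 / real (Suc n)}" for n
    by (auto simp: S_def)
  have "\<exists>p. \<forall>n. p \<in> S n"
  proof (rule decreasing_closed_nest[of S])
    fix n
    show "closed (S n)"
      unfolding S_eq f_def
      by (intro closed_Int assms closed_Collect_le continuous_intros)
    have "\<exists>c\<in>C. f c < m + 1 / real (Suc n)"
      using cInf_lessD[of "f ` C" "m + 1 / real (Suc n)"] assms(1)
      by (fastforce simp: m_def)
    then show "S n \<noteq> {}"
      by (force simp: S_def)
  next
    fix i n :: nat
    assume "i \<le> n"
    then have "1 / real (Suc n) \<le> 1 / real (Suc i)"
      by (simp add: field_simps)
    then show "S n \<subseteq> S i"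
      by (auto simp: S_def)
  next
    fix e :: real
    assume "e > 0"
    then obtain n where n: "1 / real (Suc n) < e\<^sup>2 / 4"
      using reals_Archimedean[of "e\<^sup>2 / 4"] by (auto simp: inverse_eq_divide)
    have "dist c c' < e" if "c \<in> S n" "c' \<in> S n" for c c'
    proof -
      define h where "h = (1/2) *\<^sub>R c + (1/2) *\<^sub>R c'"
      have "h \<in> C"
        unfolding h_def using that assms(3) by (intro convexD) (auto simp: S_def)
      then have "m \<le> f h"
        by (rule m_le)
      moreover have "(dist c c')\<^sup>2 = 2 * f c + 2 * f c' - 4 * f h"
        unfolding f_def dist_norm h_def power2_norm_eq_inner
        by (simp add: algebra_simps inner_commute)
      ultimately have "(dist c c')\<^sup>2 \<le> 4 * (1 / real (Suc n))"
        using that by (simp add: S_def)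
      then have "(dist c c')\<^sup>2 < e\<^sup>2"
        using n by linarith
      then show ?thesis
        using \<open>e > 0\<close> by (simp add: power2_less_imp_less)
    qed
    then show "\<exists>n. \<forall>x\<in>S n. \<forall>y\<in>S n. dist x y < e"
      by blast
  qed blast
  then obtain p where p: "p \<in> S n" for n
    by blast
  have "f p \<le> m"
  proof (rule field_le_epsilon)
    fix e :: real
    assume "e > 0"
    then obtain n where "1 / real (Suc n) < e"
      using reals_Archimedean by (auto simp: inverse_eq_divide)
    then show "f p \<le> m + e"
      using p[of n] by (simp add: S_def)
  qed
  then have "dist a p \<le> dist a q" if "q \<in> C" for q
    using m_le[OF that] by (simp add: f_def power2_le_imp_le)
  then show ?thesis
    using p[of 0] by (auto simp: S_def)
qed

lemma
  fixes C :: "'a::{real_inner, complete_space} set"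
  assumes "C \<noteq> {}" "closed C" "convex C"
  shows metric_proj_in: "metric_proj C a \<in> C"
    and metric_proj_obtuse: "u \<in> C \<Longrightarrow> inner (a - metric_proj C a) (u - metric_proj C a) \<le> 0"
proof -
  have "\<exists>p. p \<in> C \<and> (\<forall>q\<in>C. dist a p \<le> dist a q)"
    using closest_point_in_hilbert_exists[OF assms] by blast
  from someI_ex[OF this]
  have *: "metric_proj C a \<in> C" "\<forall>q\<in>C. dist a (metric_proj C a) \<le> dist a q"
    unfolding metric_proj_def by auto
  show "metric_proj C a \<in> C"
    by (fact *)
  show "inner (a - metric_proj C a) (u - metric_proj C a) \<le> 0" if "u \<in> C"
    using any_closest_point_dot[OF assms(3,2) *(1) that *(2)] .
qed

section \<open>Weak limits along filters\<close>

text \<open>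
  The representing vector is a multiple of the point \<open>p\<close> of the hyperplane \<open>f = 1\<close> that is
  closest to the origin, because \<open>p\<close> is orthogonal to the kernel of \<open>f\<close>.
\<close>

lemma riesz_representation:
  fixes f :: "'a::{real_inner, complete_space} \<Rightarrow> real"
  assumes "bounded_linear f"
  shows "\<exists>p. \<forall>h. f h = inner p h"
proof (cases "\<forall>h. f h = 0")
  case True
  then show ?thesis
    by (intro exI[of _ 0]) simp
next
  case False
  interpret bounded_linear f
    by fact
  from False obtain h0 where h0: "f h0 \<noteq> 0"
    by blast
  define H where "H = {h. f h = 1}"
  have "h0 /\<^sub>R f h0 \<in> H"
    using h0 by (simp add: H_def scaleR)
  then have "H \<noteq> {}"
    by blast
  have "closed H"
    unfolding H_def
    by (intro closed_Collect_eq continuous_intros linear_continuous_on assms)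
  have "convex H"
    unfolding H_def convex_def by (simp add: add scaleR)
  define p where "p = metric_proj H 0"
  note H = \<open>H \<noteq> {}\<close> \<open>closed H\<close> \<open>convex H\<close>
  have fp: "f p = 1"
    using metric_proj_in[OF H] by (simp add: p_def H_def)
  have p_ge: "inner p u \<ge> 0" if "f u = 0" for u
    using metric_proj_obtuse[OF H, of "p + u" 0] that fp by (simp add: p_def H_def add)
  \<comment> \<open>The kernel contains \<open>-u\<close> along with \<open>u\<close>, so the inequality is an equality.\<close>
  have orth: "inner p u = 0" if "f u = 0" for u
    using p_ge[of u] p_ge[of "-u"] that by (simp add: neg)
  have "p \<noteq> 0"
    using fp zero by auto
  have "f h = inner (p /\<^sub>R inner p p) h" for h
  proof -
    have "inner p (h - f h *\<^sub>R p) = 0"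
      by (rule orth) (simp add: diff scaleR fp)
    then show ?thesis
      using \<open>p \<noteq> 0\<close> by (simp add: inner_diff_right field_simps)
  qed
  then show ?thesis
    by blast
qed

definition weakly_tendsto :: "('i \<Rightarrow> 'a::real_inner) \<Rightarrow> 'a \<Rightarrow> 'i filter \<Rightarrow> bool" where
  "weakly_tendsto x p G \<longleftrightarrow> (\<forall>h. ((\<lambda>i. inner (x i) h) \<longlongrightarrow> inner p h) G)"

lemma weakly_tendstoD: "weakly_tendsto x p G \<Longrightarrow> ((\<lambda>i. inner (x i) h) \<longlongrightarrow> inner p h) G"
  by (simp add: weakly_tendsto_def)

lemma weakly_tendstoD': "weakly_tendsto x p G \<Longrightarrow> ((\<lambda>i. inner h (x i)) \<longlongrightarrow> inner h p) G"
  using weakly_tendstoD[of x p G h] by (simp add: inner_commute)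

lemma weakly_tendsto_add_null:
  assumes "weakly_tendsto x p G" and "((\<lambda>i. y i - x i) \<longlongrightarrow> 0) G"
  shows "weakly_tendsto y p G"
  unfolding weakly_tendsto_def
proof
  fix h
  have "((\<lambda>i. inner (x i) h + inner (y i - x i) h) \<longlongrightarrow> inner p h + inner 0 h) G"
    by (intro tendsto_intros assms weakly_tendstoD)
  then show "((\<lambda>i. inner (y i) h) \<longlongrightarrow> inner p h) G"
    by (simp add: inner_diff_left)
qed

text \<open>
  Weak compactness of balls, for filters: the functional \<open>h \<mapsto> \<langle>x\<^sub>i, h\<rangle>\<close> lies in the
  product of the compact intervals \<open>[-M \<parallel>h\<parallel>, M \<parallel>h\<parallel>]\<close>, so Tychonoff's theorem gives a cluster
  point in the topology of pointwise convergence. Pulling its neighbourhoods back to the index set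
  yields the filter, and linearity and boundedness survive the pointwise limit.
\<close>

lemma weak_cluster_point_exists:
  fixes x :: "'i \<Rightarrow> 'a::{real_inner, complete_space}"
  assumes bound: "\<And>i. norm (x i) \<le> M" and "F \<noteq> bot"
  obtains G p where "G \<le> F" "G \<noteq> bot" "weakly_tendsto x p G"
proof -
  define g where "g i = (\<lambda>h. inner (x i) h)" for i
  define K :: "('a \<Rightarrow> real) set" where "K = (\<Pi>\<^sub>E h\<in>UNIV. {- (M * norm h)..M * norm h})"
  have "compactin (product_topology (\<lambda>_. euclidean) UNIV) K"
    unfolding K_def compactin_PiE by simp
  then have "compact K"
    by (simp add: euclidean_product_topology)
  have gK: "g i \<in> K" for i
  proof -
    have "\<bar>inner (x i) h\<bar> \<le> M * norm h" for h
      using Cauchy_Schwarz_ineq2[of "x i" h] mult_right_mono[OF bound[of i], of "norm h"]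
      by simp
    then show ?thesis
      by (simp add: K_def g_def PiE_iff abs_le_iff minus_le_iff)
  qed
  have "filtermap g F \<noteq> bot" "eventually (\<lambda>l. l \<in> K) (filtermap g F)"
    using gK assms(2) by (simp_all add: eventually_filtermap filtermap_bot_iff)
  then obtain f where f: "f \<in> K" "inf (nhds f) (filtermap g F) \<noteq> bot"
    using \<open>compact K\<close> unfolding compact_filter by blast
  define G where "G = inf (filtercomap g (nhds f)) F"
  have "G \<le> F"
    by (simp add: G_def)
  have "G \<noteq> bot"
  proof
    assume "G = bot"
    then obtain P Q where PQ: "eventually P (filtercomap g (nhds f))" "eventually Q F"
      "\<And>i. P i \<Longrightarrow> Q i \<Longrightarrow> False"
      unfolding G_def trivial_limit_def eventually_inf by blast
    then obtain R where R: "eventually R (nhds f)" "\<And>i. R (g i) \<Longrightarrow> P i"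
      by (auto simp: eventually_filtercomap)
    have "eventually (\<lambda>i. \<not> R (g i)) F"
      using PQ(2) by eventually_elim (use PQ(3) R(2) in blast)
    then have "eventually (\<lambda>l. \<not> R l) (filtermap g F)"
      by (simp add: eventually_filtermap)
    then have "eventually (\<lambda>_. False) (inf (nhds f) (filtermap g F))"
      unfolding eventually_inf using R(1) by blast
    with f(2) show False
      by (simp add: trivial_limit_def)
  qed
  have "filterlim g (nhds f) G"
    unfolding filterlim_iff_le_filtercomap by (simp add: G_def)
  have g_lim: "((\<lambda>i. inner (x i) h) \<longlongrightarrow> f h) G" for h
  proof -
    have "((\<lambda>i. g i h) \<longlongrightarrow> f h) G"
      by (rule continuous_on_tendsto_compose[OF continuous_on_product_coordinates
            \<open>filterlim g (nhds f) G\<close>]) auto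
    then show ?thesis
      by (simp add: g_def)
  qed
  have "bounded_linear f"
  proof (rule bounded_linear_intro)
    fix a b :: 'a and r :: real
    have "((\<lambda>i. inner (x i) (a + b)) \<longlongrightarrow> f a + f b) G"
      unfolding inner_add_right by (intro tendsto_add g_lim)
    then show "f (a + b) = f a + f b"
      using g_lim[of "a + b"] \<open>G \<noteq> bot\<close> by (metis tendsto_unique)
    have "((\<lambda>i. inner (x i) (r *\<^sub>R a)) \<longlongrightarrow> r *\<^sub>R f a) G"
      unfolding inner_scaleR_right real_scaleR_def by (intro tendsto_mult tendsto_const g_lim)
    then show "f (r *\<^sub>R a) = r *\<^sub>R f a"
      using g_lim[of "r *\<^sub>R a"] \<open>G \<noteq> bot\<close> by (metis tendsto_unique)
    have "f a \<in> {- (M * norm a)..M * norm a}"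
      using f(1) unfolding K_def by blast
    then show "norm (f a) \<le> norm a * M"
      by (simp add: abs_le_iff mult.commute)
  qed
  then obtain p where "\<forall>h. f h = inner p h"
    using riesz_representation by blast
  then have "weakly_tendsto x p G"
    using g_lim by (simp add: weakly_tendsto_def)
  with that \<open>G \<le> F\<close> \<open>G \<noteq> bot\<close> show thesis
    by blast
qed

text \<open>
  Testing the weak limit against its own displacement from the projection shows that
  this displacement vanishes.
\<close>

lemma closed_convex_weak_limit:
  fixes C :: "'a::{real_inner, complete_space} set"
  assumes C: "closed C" "convex C" and "\<And>i. y i \<in> C"
    and "weakly_tendsto y p G" "G \<noteq> bot"
  shows "p \<in> C"
proof -
  have C': "C \<noteq> {}" "closed C" "convex C"
    using assms by auto
  define q where "q = metric_proj C p"
  have "((\<lambda>i. inner (p - q) (y i) - inner (p - q) q) \<longlongrightarrow> inner (p - q) p - inner (p - q) q) G"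
    by (intro tendsto_intros weakly_tendstoD' assms)
  moreover have "inner (p - q) (y i) - inner (p - q) q \<le> 0" for i
    using metric_proj_obtuse[OF C' assms(3), of p i] by (simp add: q_def inner_diff_right)
  ultimately have "inner (p - q) p - inner (p - q) q \<le> 0"
    using tendsto_upperbound[OF _ always_eventually] \<open>G \<noteq> bot\<close> by blast
  then have "inner (p - q) (p - q) \<le> 0"
    by (simp add: inner_diff_right)
  then have "p = q"
    by (metis inner_gt_zero_iff not_less right_minus_eq)
  then show ?thesis
    using metric_proj_in[OF C', of p] by (simp add: q_def)
qed

text \<open>
  Opial's argument: if \<open>p\<close> and \<open>q\<close> both lie in \<open>S\<close>, then \<open>\<parallel>x\<^sub>k - p\<parallel>\<^sup>2 - \<parallel>x\<^sub>k - q\<parallel>\<^sup>2\<close> is an affine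
  function of \<open>\<langle>x\<^sub>k, p - q\<rangle>\<close>, so the latter converges and has the same limit along every filter.
  Hence all weak cluster points coincide. If \<open>\<langle>x\<^sub>k, h\<rangle>\<close> stayed away from its expected limit
  infinitely often, the filter of these exceptional indices would produce a different cluster point.
\<close>

lemma opial_weak_convergence:
  fixes x :: "nat \<Rightarrow> 'a::{real_inner, complete_space}"
  assumes "S \<noteq> {}"
    and dist_conv: "\<And>z. z \<in> S \<Longrightarrow> convergent (\<lambda>k. norm (x k - z))"
    and cluster: "\<And>G p. G \<le> sequentially \<Longrightarrow> G \<noteq> bot \<Longrightarrow> weakly_tendsto x p G \<Longrightarrow> p \<in> S"
  shows "\<exists>z\<in>S. converges_weakly x z"
proof -
  obtain z where "z \<in> S"
    using assms(1) by blast
  have "Bseq (\<lambda>k. norm (x k - z))"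
    using dist_conv[OF \<open>z \<in> S\<close>] by (rule convergent_imp_Bseq)
  then obtain B where B: "\<And>k. norm (x k - z) \<le> B"
    unfolding Bseq_def by auto
  have bound: "norm (x k) \<le> B + norm z" for k
    using B[of k] norm_triangle_ineq[of "x k - z" z] by simp
  have unique: "p = q"
    if G: "G \<le> sequentially" "G \<noteq> bot" "weakly_tendsto x p G"
      and H: "H \<le> sequentially" "H \<noteq> bot" "weakly_tendsto x q H" for G H p q
  proof -
    have "p \<in> S" "q \<in> S"
      using cluster G H by auto
    then obtain lp lq where l: "(\<lambda>k. norm (x k - p)) \<longlonglongrightarrow> lp" "(\<lambda>k. norm (x k - q)) \<longlonglongrightarrow> lq"
      using dist_conv by (meson convergentD)
    have polar: "inner (x k) (p - q)
      = ((norm (x k - q))\<^sup>2 - (norm (x k - p))\<^sup>2 + inner p p - inner q q) / 2" for k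
      unfolding power2_norm_eq_inner by (simp add: algebra_simps inner_commute)
    define c where "c = (lq\<^sup>2 - lp\<^sup>2 + inner p p - inner q q) / 2"
    have "(\<lambda>k. inner (x k) (p - q)) \<longlonglongrightarrow> c"
      unfolding polar c_def by (intro tendsto_intros l) simp
    then have "inner p (p - q) = c" "inner q (p - q) = c"
      using G H weakly_tendstoD tendsto_mono tendsto_unique by metis+
    then have "inner (p - q) (p - q) = 0"
      by (simp add: inner_diff_left)
    then show "p = q"
      by simp
  qed
  obtain G p where G: "G \<le> sequentially" "G \<noteq> bot" "weakly_tendsto x p G"
    using weak_cluster_point_exists[of x, OF bound sequentially_bot] by blast
  have "(\<lambda>k. inner (x k) h) \<longlonglongrightarrow> inner p h" for h
  proof (rule ccontr)
    assume "\<not> ?thesis"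
    then obtain e where e: "e > 0"
      and not_ev: "\<not> eventually (\<lambda>k. dist (inner (x k) h) (inner p h) < e) sequentially"
      unfolding tendsto_iff by blast
    \<comment> \<open>Restricting to the exceptional indices keeps the filter nontrivial.\<close>
    define A where "A = {k. \<not> dist (inner (x k) h) (inner p h) < e}"
    have "inf sequentially (principal A) \<noteq> bot"
      using not_ev by (simp add: A_def trivial_limit_def eventually_inf_principal)
    then obtain H q where H: "H \<le> inf sequentially (principal A)" "H \<noteq> bot" "weakly_tendsto x q H"
      using weak_cluster_point_exists[of x, OF bound] by blast
    then have "q = p"
      using unique[OF _ H(2,3) G] by simp
    then have "eventually (\<lambda>k. dist (inner (x k) h) (inner p h) < e) H"
      using weakly_tendstoD[OF H(3), of h] \<open>e > 0\<close> by (simp add: tendsto_iff)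
    moreover have "eventually (\<lambda>k. k \<in> A) H"
      using H(1) by (simp add: le_principal)
    ultimately have "eventually (\<lambda>k. False) H"
      by eventually_elim (simp add: A_def)
    then show False
      using \<open>H \<noteq> bot\<close> by (simp add: trivial_limit_def)
  qed
  then show ?thesis
    using cluster[OF G] by (auto simp: converges_weakly_def)
qed

section \<open>Variational inequalities\<close>

text \<open>
  Minty's argument: apply the dual inequality at the points \<open>p + t (u - p)\<close>, divide
  by \<open>t > 0\<close>, and let \<open>t\<close> tend to 0; continuity replaces \<open>F (p + t (u - p))\<close> by \<open>F p\<close>.
\<close>

lemma minty:
  fixes C :: "'a::real_inner set"
  assumes "convex C" "continuous_on UNIV F" "p \<in> C"
    and dual: "\<And>u. u \<in> C \<Longrightarrow> inner (F u) (u - p) \<ge> 0"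
  shows "p \<in> SOL C F"
proof -
  have "inner (F p) (u - p) \<ge> 0" if "u \<in> C" for u
  proof -
    define c where "c t = p + t *\<^sub>R (u - p)" for t :: real
    have "isCont F (c 0)"
      using assms(2) by (simp add: continuous_on_eq_continuous_at)
    moreover have "(c \<longlongrightarrow> c 0) (at_right 0)"
      unfolding c_def by (intro tendsto_intros)
    ultimately have "((\<lambda>t. F (c t)) \<longlongrightarrow> F (c 0)) (at_right 0)"
      by (rule isCont_tendsto_compose)
    then have lim: "((\<lambda>t. inner (F (c t)) (u - p)) \<longlongrightarrow> inner (F (c 0)) (u - p)) (at_right 0)"
      by (intro tendsto_intros)
    have "inner (F (c t)) (u - p) \<ge> 0" if "0 < t" "t < 1" for t
    proof -
      have "c t = (1 - t) *\<^sub>R p + t *\<^sub>R u"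
        by (simp add: c_def algebra_simps)
      then have "c t \<in> C"
        using convexD_alt[OF assms(1) \<open>p \<in> C\<close> \<open>u \<in> C\<close>, of t] that by simp
      from dual[OF this] show ?thesis
        using that by (simp add: c_def zero_le_mult_iff)
    qed
    then have "eventually (\<lambda>t. inner (F (c t)) (u - p) \<ge> 0) (at_right 0)"
      using eventually_at_right_less eventually_at_right_real[of 0 1]
      by (auto elim: eventually_mono)
    then have "inner (F (c 0)) (u - p) \<ge> 0"
      using lim by (intro tendsto_lowerbound) auto
    then show ?thesis
      by (simp add: c_def)
  qed
  with \<open>p \<in> C\<close> show ?thesis
    by (simp add: SOL_def)
qed

text \<open>
  A bound on how far a projected step \<open>y\<close> from \<open>w\<close> is from solving the dual problem. For \<open>y\<close> in
  a bounded set it is of the order of \<open>\<parallel>w - y\<parallel>\<close>, so \<open>w - y \<rightarrow> 0\<close> suffices in the limit. Dividing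
  the projection inequality by \<open>\<beta>\<close> is why the step sizes must stay away from zero.
\<close>

lemma projection_step_dual_gap:
  fixes C :: "'a::{real_inner, complete_space} set"
  assumes C: "closed C" "convex C" and mono: "monotone_operator F"
    and lip: "L-lipschitz_on UNIV F" and "u \<in> C"
    and y: "y = metric_proj C (w - \<beta> *\<^sub>R F w)" and "0 < b" "b \<le> \<beta>"
  shows "inner (F u) (u - y) \<ge> - ((1 / b + L) * norm (w - y) * norm (u - y))"
proof -
  have "C \<noteq> {}"
    using \<open>u \<in> C\<close> by blast
  have "inner (w - \<beta> *\<^sub>R F w - y) (u - y) \<le> 0"
    using metric_proj_obtuse[OF \<open>C \<noteq> {}\<close> C \<open>u \<in> C\<close>, of "w - \<beta> *\<^sub>R F w"] by (simp add: y)
  then have "\<beta> * inner (F w) (u - y) \<ge> inner (w - y) (u - y)"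
    by (simp add: inner_diff_left)
  moreover have "\<bar>inner (w - y) (u - y)\<bar> \<le> norm (w - y) * norm (u - y)"
    by (rule Cauchy_Schwarz_ineq2)
  ultimately have "\<beta> * inner (F w) (u - y) \<ge> - (norm (w - y) * norm (u - y))"
    by linarith
  then have "inner (F w) (u - y) \<ge> - (norm (w - y) * norm (u - y)) / \<beta>"
    using assms(7,8) by (simp add: field_simps)
  moreover have "norm (w - y) * norm (u - y) / \<beta> \<le> norm (w - y) * norm (u - y) / b"
    using assms(7,8) by (intro divide_left_mono) auto
  ultimately have 1: "inner (F w) (u - y) \<ge> - (norm (w - y) * norm (u - y) / b)"
    by simp
  have "\<bar>inner (F y - F w) (u - y)\<bar> \<le> norm (F y - F w) * norm (u - y)"
    by (rule Cauchy_Schwarz_ineq2)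
  also have "\<dots> \<le> L * norm (w - y) * norm (u - y)"
    using lipschitz_onD[OF lip, of y w]
    by (intro mult_right_mono) (auto simp: dist_norm norm_minus_commute)
  finally have 2: "inner (F y - F w) (u - y) \<ge> - (L * norm (w - y) * norm (u - y))"
    by linarith
  have "inner (F u - F y) (u - y) \<ge> 0"
    using mono by (simp add: monotone_operator_def)
  then have "inner (F u) (u - y) \<ge> inner (F w) (u - y) + inner (F y - F w) (u - y)"
    by (simp add: inner_diff_left)
  with 1 2 show ?thesis
    by (simp add: algebra_simps)
qed

section \<open>Decrease of the distance to solutions\<close>

text \<open>
  Expanding the square, the cross term is bounded through the separation
  \<open>\<langle>w - z, d\<rangle> \<ge> \<langle>w - y, d\<rangle> = \<rho> \<parallel>d\<parallel>\<^sup>2\<close>, where \<open>d\<close> is the direction and \<open>\<rho>\<close> the step; this leaves a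
  decrease of \<open>\<gamma> (2 - \<gamma>) \<rho>\<^sup>2 \<parallel>d\<parallel>\<^sup>2\<close>. The step size test makes \<open>d\<close> comparable to \<open>w - y\<close>:
  \<open>\<langle>w - y, d\<rangle> \<ge> (1 - \<nu>) \<parallel>w - y\<parallel>\<^sup>2\<close> and \<open>\<parallel>d\<parallel> \<le> (1 + \<nu>) \<parallel>w - y\<parallel>\<close>, hence
  \<open>\<rho> \<parallel>d\<parallel> \<ge> (1 - \<nu>) / (1 + \<nu>) \<parallel>w - y\<parallel>\<close>.
\<close>

lemma pc_update_decrease:
  fixes C :: "'a::{real_inner, complete_space} set"
  assumes C: "closed C" "convex C" and mono: "monotone_operator F" and z: "z \<in> SOL C F"
    and \<nu>: "0 < \<nu>" "\<nu> < 1" and \<gamma>: "0 < \<gamma>" "\<gamma> < 2" and "\<beta> > 0"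
    and y: "y = metric_proj C (w - \<beta> *\<^sub>R F w)"
    and test: "\<beta> * norm (F w - F y) \<le> \<nu> * norm (w - y)"
    and nz: "pc_direction F \<beta> w y \<noteq> 0"
    and x': "x' = w - (\<gamma> * pc_step F \<beta> w y) *\<^sub>R pc_direction F \<beta> w y"
  shows "(norm (x' - z))\<^sup>2
    \<le> (norm (w - z))\<^sup>2 - \<gamma> * (2 - \<gamma>) * ((1 - \<nu>) / (1 + \<nu>))\<^sup>2 * (norm (w - y))\<^sup>2"
proof -
  define d where "d = pc_direction F \<beta> w y"
  define \<rho> where "\<rho> = pc_step F \<beta> w y"
  define N where "N = norm (w - y)"
  have d: "d = (w - y) - \<beta> *\<^sub>R (F w - F y)" "d \<noteq> 0"
    using nz by (simp_all add: d_def pc_direction_def)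
  have "z \<in> C"
    using z by (simp add: SOL_def)
  then have "C \<noteq> {}"
    by blast
  have "y \<in> C"
    unfolding y by (rule metric_proj_in[OF \<open>C \<noteq> {}\<close> C])
  have proj: "inner (w - \<beta> *\<^sub>R F w - y) (z - y) \<le> 0"
    using metric_proj_obtuse[OF \<open>C \<noteq> {}\<close> C \<open>z \<in> C\<close>, of "w - \<beta> *\<^sub>R F w"] by (simp add: y)
  have "inner (F z) (y - z) \<ge> 0" "inner (F y - F z) (y - z) \<ge> 0"
    using z mono \<open>y \<in> C\<close> by (simp_all add: SOL_def monotone_operator_def)
  then have "inner (F y) (y - z) \<ge> 0"
    by (simp add: inner_diff_left)
  then have "\<beta> * inner (F y) (y - z) \<ge> 0"
    using \<open>\<beta> > 0\<close> by simp
  moreover have "inner (y - z) d = - inner (w - \<beta> *\<^sub>R F w - y) (z - y) + \<beta> * inner (F y) (y - z)"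
    unfolding d(1) by (simp add: inner_commute algebra_simps)
  ultimately have "inner (y - z) d \<ge> 0"
    using proj by linarith
  then have sep: "inner (w - z) d \<ge> inner (w - y) d"
    by (simp add: inner_diff_left)
  have \<rho>: "\<rho> * (norm d)\<^sup>2 = inner (w - y) d"
    using d(2) by (simp add: \<rho>_def pc_step_def d_def)

  have small: "norm (\<beta> *\<^sub>R (F w - F y)) \<le> \<nu> * N"
    using test \<open>\<beta> > 0\<close> by (simp add: N_def)
  have "inner (w - y) (\<beta> *\<^sub>R (F w - F y)) \<le> N * norm (\<beta> *\<^sub>R (F w - F y))"
    unfolding N_def by (rule norm_cauchy_schwarz)
  also have "\<dots> \<le> N * (\<nu> * N)"
    using small by (intro mult_left_mono) (auto simp: N_def)
  finally have inner_ge: "inner (w - y) d \<ge> (1 - \<nu>) * N\<^sup>2"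
    unfolding d(1) inner_diff_right[of "w - y" "w - y"]
    by (simp add: N_def power2_norm_eq_inner[symmetric] algebra_simps power2_eq_square)
  have d_le: "norm d \<le> (1 + \<nu>) * N"
    using norm_triangle_ineq4[of "w - y" "\<beta> *\<^sub>R (F w - F y)"] small
    by (simp add: d(1) N_def algebra_simps)
  have "N > 0"
    using d_le d(2) \<nu> by (smt (verit) N_def mult_eq_0_iff norm_ge_zero zero_less_norm_iff)
  have "\<rho> \<ge> 0"
    using order_trans[OF _ inner_ge, of 0] \<nu> by (simp add: \<rho>_def pc_step_def d_def[symmetric])
  have "(1 - \<nu>) * N\<^sup>2 \<le> \<rho> * norm d * norm d"
    using inner_ge \<rho> by (simp add: power2_eq_square mult.assoc)
  also have "\<dots> \<le> \<rho> * norm d * ((1 + \<nu>) * N)"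
    using d_le \<open>\<rho> \<ge> 0\<close> by (intro mult_left_mono) auto
  finally have "(1 - \<nu>) * N \<le> \<rho> * norm d * (1 + \<nu>)"
    using \<open>N > 0\<close> by (simp add: power2_eq_square)
  then have "(1 - \<nu>) / (1 + \<nu>) * N \<le> \<rho> * norm d"
    using \<nu> by (simp add: divide_simps)
  then have "((1 - \<nu>) / (1 + \<nu>) * N)\<^sup>2 \<le> (\<rho> * norm d)\<^sup>2"
    using \<nu> \<open>N > 0\<close> by (intro power_mono) auto
  then have gain: "\<gamma> * (2 - \<gamma>) * (((1 - \<nu>) / (1 + \<nu>))\<^sup>2 * N\<^sup>2) \<le> \<gamma> * (2 - \<gamma>) * (\<rho>\<^sup>2 * (norm d)\<^sup>2)"
    using \<gamma> by (intro mult_left_mono) (auto simp: power_mult_distrib power_divide)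

  have expand: "(norm (a - r *\<^sub>R d))\<^sup>2 = (norm a)\<^sup>2 - 2 * r * inner a d + r\<^sup>2 * (norm d)\<^sup>2" for a r
    unfolding power2_norm_eq_inner
    by (simp add: inner_diff_left inner_diff_right inner_commute power2_eq_square algebra_simps)
  have "x' - z = (w - z) - (\<gamma> * \<rho>) *\<^sub>R d"
    by (simp add: x' \<rho>_def d_def)
  then have "(norm (x' - z))\<^sup>2
      = (norm (w - z))\<^sup>2 - 2 * (\<gamma> * \<rho>) * inner (w - z) d + (\<gamma> * \<rho>)\<^sup>2 * (norm d)\<^sup>2"
    by (simp only: expand)
  also have "\<dots> \<le> (norm (w - z))\<^sup>2 - 2 * (\<gamma> * \<rho>) * (\<rho> * (norm d)\<^sup>2) + (\<gamma> * \<rho>)\<^sup>2 * (norm d)\<^sup>2"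
    using sep \<gamma> \<open>\<rho> \<ge> 0\<close> by (simp add: \<rho> mult_left_mono)
  also have "\<dots> = (norm (w - z))\<^sup>2 - \<gamma> * (2 - \<gamma>) * (\<rho>\<^sup>2 * (norm d)\<^sup>2)"
    by (simp add: power2_eq_square algebra_simps)
  also have "\<dots> \<le> (norm (w - z))\<^sup>2 - \<gamma> * (2 - \<gamma>) * (((1 - \<nu>) / (1 + \<nu>))\<^sup>2 * N\<^sup>2)"
    using gain by linarith
  finally show ?thesis
    by (simp add: N_def mult.assoc)
qed

text \<open>
  Subtracting the partial sums of the errors turns the sequence into a decreasing one
  that is still bounded below. The error term is the cost of the perturbation.
\<close>

lemma convergent_quasi_decreasing:
  fixes a e :: "nat \<Rightarrow> real"
  assumes "\<And>k. 0 \<le> a k" "\<And>k. a (Suc k) \<le> a k + e k" "\<And>k. 0 \<le> e k" "summable e"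
  shows "convergent a"
proof -
  define b where "b k = a k - sum e {..<k}" for k
  have "decseq b"
    by (rule decseq_SucI) (use assms(2) in \<open>simp add: b_def algebra_simps\<close>)
  moreover have "- suminf e \<le> b k" for k
    using sum_le_suminf[OF assms(4), of "{..<k}"] assms(1)[of k] assms(3) by (simp add: b_def)
  ultimately obtain l where "b \<longlonglongrightarrow> l"
    using decseq_convergent[of b "- suminf e"] by blast
  from tendsto_add[OF this summable_LIMSEQ[OF assms(4)]] have "a \<longlonglongrightarrow> l + suminf e"
    by (simp add: b_def)
  then show ?thesis
    by (rule convergentI)
qed

section \<open>Convergence of the perturbed method\<close>

theorem theorem4p4:
  fixes C :: "'a::{real_inner, complete_space} set"
    and F :: "'a \<Rightarrow> 'a"
    and v x y :: "nat \<Rightarrow> 'a"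
    and lam \<beta> :: "nat \<Rightarrow> real"
    and \<nu> \<gamma> L :: real
  assumes "C \<noteq> {}" "closed C" "convex C"
    and "SOL C F \<noteq> {}"
    and "monotone_operator F"
    and "L > 0" "L-lipschitz_on UNIV F"
    and "0 < \<nu>" "\<nu> < 1"
    and "0 < \<gamma>" "\<gamma> < 2"
    and "bounded (range v)"
    and "\<And>k. lam k > 0" "summable lam"
    and "pc_algorithm_I_perturbed C F \<nu> \<gamma> v lam \<beta> x y"
    and step_bounded_below: "\<exists>b>0. \<forall>k. b \<le> \<beta> k"
  shows "\<exists>z\<in>SOL C F. converges_weakly x z"
proof -
  define w where "w k = x k + lam k *\<^sub>R v k" for k
  have \<beta>_pos: "\<beta> k > 0"
    and y: "y k = metric_proj C (w k - \<beta> k *\<^sub>R F (w k))"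
    and test: "\<beta> k * norm (F (w k) - F (y k)) \<le> \<nu> * norm (w k - y k)"
    and nz: "pc_direction F (\<beta> k) (w k) (y k) \<noteq> 0"
    and x_Suc: "x (Suc k) = w k - (\<gamma> * pc_step F (\<beta> k) (w k) (y k)) *\<^sub>R pc_direction F (\<beta> k) (w k) (y k)"
    for k
    using assms(15) unfolding pc_algorithm_I_perturbed_def w_def Let_def by blast+
  define c where "c = \<gamma> * (2 - \<gamma>) * ((1 - \<nu>) / (1 + \<nu>))\<^sup>2"
  have "c > 0"
    using assms(8-11) by (simp add: c_def)
  have decrease: "(norm (x (Suc k) - z))\<^sup>2 \<le> (norm (w k - z))\<^sup>2 - c * (norm (w k - y k))\<^sup>2"
    if "z \<in> SOL C F" for z k
    unfolding c_def
    by (rule pc_update_decrease[OF assms(2,3,5) that assms(8-11) \<beta>_pos y test nz x_Suc])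

  obtain M where M: "\<And>k. norm (v k) \<le> M"
    using assms(12) by (auto simp: bounded_iff)
  have "0 \<le> M"
    using norm_ge_zero M by (rule order_trans)
  have wx: "norm (w k - x k) \<le> lam k * M" for k
    using M[of k] assms(13)[of k] by (simp add: w_def)
  have lamM: "summable (\<lambda>k. lam k * M)"
    using assms(14) by (rule summable_mult2)
  have wx_lim: "(\<lambda>k. w k - x k) \<longlonglongrightarrow> 0"
    by (rule Lim_null_comparison[OF always_eventually summable_LIMSEQ_zero[OF lamM]])
      (simp add: wx)

  have dist_conv: "convergent (\<lambda>k. norm (x k - z))" if "z \<in> SOL C F" for z
  proof (rule convergent_quasi_decreasing)
    fix k
    have "c * (norm (w k - y k))\<^sup>2 \<ge> 0"
      using \<open>c > 0\<close> by simp
    then have "(norm (x (Suc k) - z))\<^sup>2 \<le> (norm (w k - z))\<^sup>2"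
      using decrease[OF that, of k] by linarith
    then have "norm (x (Suc k) - z) \<le> norm (w k - z)"
      by (rule power2_le_imp_le) simp
    also have "\<dots> \<le> norm (x k - z) + norm (w k - x k)"
      using norm_triangle_ineq[of "x k - z" "w k - x k"] by simp
    finally show "norm (x (Suc k) - z) \<le> norm (x k - z) + lam k * M"
      using wx[of k] by linarith
    show "0 \<le> lam k * M"
      using assms(13)[of k] \<open>0 \<le> M\<close> by simp
  qed (use lamM in auto)

  \<comment> \<open>For one solution \<open>z\<close>, both \<open>\<parallel>w\<^sub>k - z\<parallel>\<close> and \<open>\<parallel>x\<^sub>k\<^sub>+\<^sub>1 - z\<parallel>\<close> have the limit \<open>l\<close>, so the drop between them vanishes.\<close>
  have wy_lim: "(\<lambda>k. w k - y k) \<longlonglongrightarrow> 0"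
  proof -
    obtain z where z: "z \<in> SOL C F"
      using assms(4) by blast
    then obtain l where l: "(\<lambda>k. norm (x k - z)) \<longlonglongrightarrow> l"
      using dist_conv by (meson convergentD)
    have "(\<lambda>k. norm (w k - z) - norm (x k - z)) \<longlonglongrightarrow> 0"
    proof (rule Lim_null_comparison)
      show "eventually (\<lambda>k. norm (norm (w k - z) - norm (x k - z)) \<le> norm (w k - x k)) sequentially"
        using norm_triangle_ineq3[of "w k - z" "x k - z" for k] by (intro always_eventually) simp
      show "(\<lambda>k. norm (w k - x k)) \<longlonglongrightarrow> 0"
        using wx_lim by (rule tendsto_norm_zero)
    qed
    from tendsto_add[OF this l] have "(\<lambda>k. norm (w k - z)) \<longlonglongrightarrow> l"
      by simp
    then have "(\<lambda>k. ((norm (w k - z))\<^sup>2 - (norm (x (Suc k) - z))\<^sup>2) / c) \<longlonglongrightarrow> (l\<^sup>2 - l\<^sup>2) / c"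
      using LIMSEQ_Suc[OF l] \<open>c > 0\<close> by (intro tendsto_intros) auto
    then have bound_lim: "(\<lambda>k. ((norm (w k - z))\<^sup>2 - (norm (x (Suc k) - z))\<^sup>2) / c) \<longlonglongrightarrow> 0"
      by simp
    have "(\<lambda>k. (norm (w k - y k))\<^sup>2) \<longlonglongrightarrow> 0"
    proof (rule Lim_null_comparison[OF always_eventually bound_lim], rule allI)
      fix k
      show "norm ((norm (w k - y k))\<^sup>2) \<le> ((norm (w k - z))\<^sup>2 - (norm (x (Suc k) - z))\<^sup>2) / c"
        using decrease[OF z, of k] \<open>c > 0\<close> by (simp add: field_simps)
    qed
    then have "(\<lambda>k. norm (w k - y k)) \<longlonglongrightarrow> 0"
      by simp
    then show ?thesis
      by (rule tendsto_norm_zero_cancel)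
  qed
  have yx_lim: "(\<lambda>k. y k - x k) \<longlonglongrightarrow> 0"
    using tendsto_diff[OF wx_lim wy_lim] by simp

  \<comment> \<open>The dual gap carries the factor \<open>\<parallel>u - y\<^sub>k\<parallel>\<close>, which a bound on \<open>y\<close> keeps under control.\<close>
  have y_bounded: "Bseq y"
  proof -
    obtain z where "z \<in> SOL C F"
      using assms(4) by blast
    have "Bseq (\<lambda>k. x k - z)"
      using convergent_imp_Bseq[OF dist_conv[OF \<open>z \<in> SOL C F\<close>]] by (simp add: Bseq_def)
    moreover have "Bseq (\<lambda>k. y k - x k)"
      using yx_lim convergentI convergent_imp_Bseq by blast
    ultimately obtain A B where "\<And>k. norm (x k - z) \<le> A" "\<And>k. norm (y k - x k) \<le> B"
      unfolding Bseq_def by auto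
    then have "norm (y k) \<le> A + B + norm z" for k
      using norm_triangle_ineq[of "(x k - z) + (y k - x k)" z]
        norm_triangle_ineq[of "x k - z" "y k - x k"]
      by (smt (verit) add_diff_cancel_left' add_diff_eq diff_add_cancel add.commute)
    then show ?thesis
      by (rule BseqI')
  qed

  obtain b where b: "b > 0" "\<And>k. b \<le> \<beta> k"
    using step_bounded_below by blast
  have cluster: "p \<in> SOL C F" if G: "G \<le> sequentially" "G \<noteq> bot" "weakly_tendsto x p G" for G p
  proof (rule minty)
    have y_weak: "weakly_tendsto y p G"
      using weakly_tendsto_add_null[OF G(3)] tendsto_mono[OF G(1) yx_lim] .
    show "p \<in> C"
      using closed_convex_weak_limit[OF assms(2,3) _ y_weak G(2)] metric_proj_in[OF assms(1-3)] y
      by metis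
    show "continuous_on UNIV F"
      using assms(7) by (rule lipschitz_on_continuous_on)
    fix u
    assume "u \<in> C"
    obtain K where K: "\<And>k. norm (y k) \<le> K"
      using y_bounded unfolding Bseq_def by auto
    have gap: "inner (F u) (u - y k) \<ge> - ((1 / b + L) * norm (w k - y k) * (norm u + K))" for k
    proof -
      have "norm (u - y k) \<le> norm u + K"
        using norm_triangle_ineq4[of u "y k"] K[of k] by linarith
      then have "(1 / b + L) * norm (w k - y k) * norm (u - y k)
          \<le> (1 / b + L) * norm (w k - y k) * (norm u + K)"
        using b(1) \<open>L > 0\<close> by (intro mult_left_mono) auto
      then show ?thesis
        using projection_step_dual_gap[OF assms(2,3,5,7) \<open>u \<in> C\<close> y b(1) b(2), of k] by linarith
    qed
    have "(\<lambda>k. - ((1 / b + L) * norm (w k - y k) * (norm u + K)))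
        \<longlonglongrightarrow> - ((1 / b + L) * 0 * (norm u + K))"
      by (intro tendsto_intros tendsto_norm_zero wy_lim)
    then have gap_lim: "((\<lambda>k. - ((1 / b + L) * norm (w k - y k) * (norm u + K))) \<longlongrightarrow> 0) G"
      using tendsto_mono[OF G(1)] by simp
    have inner_lim: "((\<lambda>k. inner (F u) u - inner (F u) (y k)) \<longlongrightarrow> inner (F u) u - inner (F u) p) G"
      by (intro tendsto_intros weakly_tendstoD' y_weak)
    have "0 \<le> inner (F u) u - inner (F u) p"
      by (rule tendsto_le[OF G(2) inner_lim gap_lim always_eventually])
        (use gap in \<open>simp add: inner_diff_right\<close>)
    then show "inner (F u) (u - p) \<ge> 0"
      by (simp add: inner_diff_right)
  qed (rule assms(3))
  show ?thesis
    using opial_weak_convergence[OF assms(4) dist_conv cluster] .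
qed

end
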